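(* In the logistic regression model with linear restrictions $H\beta=h$, let $0<d<1$, $L_d=I-(1-d)^2(C+I)^{-2}$, $A=C^{-1}-C^{-1}H'(HC^{-1}H')^{-1}HC^{-1}$ and $b_1=(L_d-I)\beta$. Assume that $\lambda_{max}(L_dAL_d(ACA)^-)\le 1$ and $\Re(L_dAL_d)\subset\Re(ACA)$. Then $\hat\beta_{RAULE}$ is superior to $\hat\beta_{RMLE}$ in the MMSE sense, i.e. $MMSE(\hat\beta_{RMLE})-MMSE(\hat\beta_{RAULE})\ge 0$, if and only if $$b_1'(ACA-L_dAL_d)^+b_1\le 1\quad\text{and}\quad b_1\in\Re(ACA-L_dAL_d).$$
   Context: Logistic regression model: $y_i=\pi_i+\varepsilon_i$, $i=1,\dots,n$, with $y_i$ Bernoulli of parameter $\pi_i=\exp(x_i'\beta)/(1+\exp(x_i'\beta))$, where $\beta\in\mathbb{R}^{p+1}$ is the unknown coefficient vector and $x_i'$ is the $i$th row of the $n\times(p+1)$ data matrix $X$. A prime denotes transpose. Let $C=X'\hat WX$, where $\hat W=\mathrm{Diag}(\hat\pi_i(1-\hat\pi_i))$. Convention (usual large-sample treatment): $C$ is a fixed symmetric positive definite $(p+1)\times(p+1)$ matrix, and the maximum likelihood estimator $\hat\beta_{MLE}$ is a random vector in $\mathbb{R}^{p+1}$ with $E(\hat\beta_{MLE})=\beta$ and $Cov(\hat\beta_{MLE})=C^{-1}$; no other property of the model is used. $H$ is a known $q\times(p+1)$ matrix of full row rank $q\le p+1$, $h\in\mathbb{R}^q$ is known, and the restrictions $H\beta=h$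 are assumed to hold. The restricted MLE is $$\hat\beta_{RMLE}=\hat\beta_{MLE}-C^{-1}H'(HC^{-1}H')^{-1}(H\hat\beta_{MLE}-h),$$ and the restricted almost unbiased Liu estimator is $\hat\beta_{RAULE}=L_d\hat\beta_{RMLE}$. For an estimator $\hat\theta$ of $\theta$, $MMSE(\hat\theta)=E[(\hat\theta-\theta)(\hat\theta-\theta)']$. For symmetric $M$, $M\ge 0$ means $M$ is nonnegative definite. $\Re(M)$ is the column space of $M$, $M^+$ the Moore–Penrose inverse, $M^-$ any generalized inverse (i.e. $MM^-M=M$), and $\lambda_{max}$ the largest eigenvalue; under the range inclusion in the hypothesis, the condition $\lambda_{max}(L_dAL_d(ACA)^-)\le1$ does not depend on the choice of $(ACA)^-$. *)

theory Defs
  imports "HOL-Probability.Probability"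
begin

section \<open>Matrices\<close>

definition nonneg_definite :: "real^'n^'n \<Rightarrow> bool" where
  "nonneg_definite M \<longleftrightarrow> transpose M = M \<and> (\<forall>x. 0 \<le> x \<bullet> (M *v x))"

definition pos_definite :: "real^'n^'n \<Rightarrow> bool" where
  "pos_definite M \<longleftrightarrow> transpose M = M \<and> (\<forall>x. x \<noteq> 0 \<longrightarrow> 0 < x \<bullet> (M *v x))"

definition column_space :: "real^'n^'m \<Rightarrow> (real^'m) set" where
  "column_space M = span (columns M)"

definition ginverse :: "real^'n^'m \<Rightarrow> real^'m^'n \<Rightarrow> bool" where
  "ginverse M G \<longleftrightarrow> M ** G ** M = M"

definition is_moore_penrose :: "real^'n^'m \<Rightarrow> real^'m^'n \<Rightarrow> bool" where
  "is_moore_penrose M G \<longleftrightarrow>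
     M ** G ** M = M \<and> G ** M ** G = G \<and>
     transpose (M ** G) = M ** G \<and> transpose (G ** M) = G ** M"

definition moore_penrose :: "real^'n^'m \<Rightarrow> real^'m^'n" where
  "moore_penrose M = (THE G. is_moore_penrose M G)"

definition eigenvalues :: "real^'n^'n \<Rightarrow> real set" where
  "eigenvalues M = {l. \<exists>v. v \<noteq> 0 \<and> M *v v = l *\<^sub>R v}"

text \<open>The largest eigenvalue presupposes that the (complex) eigenvalues are real, so that there is
  at least one real eigenvalue. This holds for the matrices \<open>N ** G\<close> with \<open>M\<close>, \<open>N\<close> nonnegative
  definite, \<open>column_space N \<subseteq> column_space M\<close> and \<open>ginverse M G\<close>, even though \<open>N ** G\<close> need not
  be symmetric.\<close>

definition lambda_max :: "real^'n^'n \<Rightarrow> real" where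
  "lambda_max M = Max (eigenvalues M)"


section \<open>Moments of random vectors\<close>

definition outer :: "real^'m \<Rightarrow> real^'n \<Rightarrow> real^'n^'m" where
  "outer u v = (\<chi> i j. u $ i * v $ j)"

text \<open>Expectations of vectors and matrices are Bochner integrals; for integrable arguments they are
  the entrywise expectations.\<close>

definition covariance_matrix :: "'w measure \<Rightarrow> ('w \<Rightarrow> real^'n) \<Rightarrow> real^'n^'n" where
  "covariance_matrix P X =
     (let \<mu> = integral\<^sup>L P X
      in (LINT \<omega>|P. outer (X \<omega> - \<mu>) (X \<omega> - \<mu>)))"

definition MMSE :: "'w measure \<Rightarrow> ('w \<Rightarrow> real^'n) \<Rightarrow> real^'n \<Rightarrow> real^'n^'n" where
  "MMSE P X \<theta> = (LINT \<omega>|P. outer (X \<omega> - \<theta>) (X \<omega> - \<theta>))"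


section \<open>The restricted estimators\<close>

definition liu_matrix :: "real^'n^'n \<Rightarrow> real \<Rightarrow> real^'n^'n" where
  "liu_matrix C d =
     mat 1 - (1 - d)\<^sup>2 *\<^sub>R (matrix_inv (C + mat 1) ** matrix_inv (C + mat 1))"

definition restr_matrix :: "real^'n^'n \<Rightarrow> real^'n^'q \<Rightarrow> real^'n^'n" where
  "restr_matrix C H =
     matrix_inv C
     - matrix_inv C ** transpose H ** matrix_inv (H ** matrix_inv C ** transpose H)
       ** H ** matrix_inv C"

text \<open>The estimators below are functions of the value \<open>b\<close> of the maximum likelihood estimator.\<close>

definition RMLE :: "real^'n^'n \<Rightarrow> real^'n^'q \<Rightarrow> real^'q \<Rightarrow> real^'n \<Rightarrow> real^'n" where
  "RMLE C H h b =
     b - (matrix_inv C ** transpose H ** matrix_inv (H ** matrix_inv C ** transpose H))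
         *v (H *v b - h)"

definition RAULE ::
    "real^'n^'n \<Rightarrow> real^'n^'q \<Rightarrow> real^'q \<Rightarrow> real \<Rightarrow> real^'n \<Rightarrow> real^'n" where
  "RAULE C H h d b = liu_matrix C d *v RMLE C H h b"

definition MMSE_superior ::
    "'w measure \<Rightarrow> real^'n \<Rightarrow> ('w \<Rightarrow> real^'n) \<Rightarrow> ('w \<Rightarrow> real^'n) \<Rightarrow> bool" where
  "MMSE_superior P \<theta> X Y \<longleftrightarrow> nonneg_definite (MMSE P Y \<theta> - MMSE P X \<theta>)"

end

theory Submission
  imports Defs
begin

text \<open>Since \<open>A C A = A\<close>, the restricted estimator has mean square error matrix \<open>A\<close>, and the Liu
  version has \<open>L A L + b\<^sub>1 b\<^sub>1\<^sup>T\<close>. The eigenvalue and range hypotheses imply that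
  \<open>D = A - L A L\<close> is nonnegative definite, because the supremum of the quotient of the quadratic forms
  of \<open>L A L\<close> and \<open>A\<close> is an eigenvalue of \<open>L A L G\<close>. Finally \<open>D - b b\<^sup>T\<close> is nonnegative definite iff
  \<open>b = D z\<close> for some \<open>z\<close> with \<open>z\<^sup>T D z \<le> 1\<close>.\<close>

subsection \<open>Symmetric matrices and generalized inverses\<close>

lemma inner_matrix_transpose:
  fixes M :: "real^'n^'m"
  shows "x \<bullet> (M *v y) = (transpose M *v x) \<bullet> y"
  by (simp add: dot_lmul_matrix)

lemma inner_matrix_symmetric:
  fixes M :: "real^'n^'n"
  assumes "transpose M = M"
  shows "x \<bullet> (M *v y) = (M *v x) \<bullet> y"
  using inner_matrix_transpose[of x M y] assms by simp

lemma matrix_diff_ldistrib: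
  fixes A :: "real^'n^'m" and B C :: "real^'k^'n"
  shows "A ** (B - C) = A ** B - A ** C"
  by (simp add: matrix_eq matrix_vector_mult_diff_distrib matrix_vector_mult_diff_rdistrib
      flip: matrix_vector_mul_assoc)

lemma matrix_diff_rdistrib:
  fixes A B :: "real^'n^'m" and C :: "real^'k^'n"
  shows "(A - B) ** C = A ** C - B ** C"
  by (simp add: matrix_eq matrix_vector_mult_diff_rdistrib flip: matrix_vector_mul_assoc)

lemma transpose_diff: "transpose (A - B) = transpose A - transpose (B :: real^'n^'m)"
  by (simp add: transpose_def vec_eq_iff)

lemma transpose_add: "transpose (A + B) = transpose A + transpose (B :: real^'n^'m)"
  by (simp add: transpose_def vec_eq_iff)

lemma transpose_scaleR: "transpose (c *\<^sub>R A) = c *\<^sub>R transpose (A :: real^'n^'m)"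
  by (simp add: transpose_def vec_eq_iff)

lemma matrix_inv_invertible:
  fixes A :: "real^'n^'n"
  assumes "invertible A"
  shows "A ** matrix_inv A = mat 1" and "matrix_inv A ** A = mat 1"
  using someI_ex[OF assms[unfolded invertible_def]] by (auto simp: matrix_inv_def)

lemma transpose_matrix_inv_symmetric:
  fixes A :: "real^'n^'n"
  assumes "invertible A" "transpose A = A"
  shows "transpose (matrix_inv A) = matrix_inv A"
proof -
  have "transpose (matrix_inv A) ** A = mat 1"
    using arg_cong[OF matrix_inv_invertible(1)[OF assms(1)], of transpose] assms(2)
    by (simp add: matrix_transpose_mul)
  then have "transpose (matrix_inv A) ** A ** matrix_inv A = matrix_inv A"
    by simp
  then show ?thesis
    by (simp add: matrix_inv_invertible(1)[OF assms(1)] flip: matrix_mul_assoc)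
qed

lemma column_space_eq_range: "column_space M = range ((*v) (M :: real^'n^'m))"
proof -
  have "columns M = (*v) M ` range (\<lambda>i. axis i 1)"
    by (rule columns_image_basis)
  moreover have "range (\<lambda>i. axis i 1 :: real^'n) = Basis"
    by (auto simp: Basis_vec_def)
  ultimately show ?thesis
    by (simp add: column_space_def linear_span_image)
qed

text \<open>Every column of \<open>N\<close> lies in the range of \<open>M\<close>; chosen preimages
  of the columns form the columns of \<open>Z\<close>.\<close>

lemma column_space_subset_factor:
  fixes N :: "real^'n^'m" and M :: "real^'k^'m"
  assumes "column_space N \<subseteq> column_space M"
  obtains Z where "N = M ** Z"
proof -
  have "\<exists>z. N *v axis i 1 = M *v z" for i
    using assms by (auto simp: column_space_eq_range image_subset_iff)
  then obtain z where z: "N *v axis i 1 = M *v z i" for i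
    by metis
  \<comment> \<open>The vectors \<open>z i\<close> are the rows of \<open>\<chi> i. z i\<close>,
    hence the transpose.\<close>
  have "N = M ** transpose (\<chi> i. z i)"
  proof -
    have "N $ i $ j = (M ** transpose (\<chi> i. z i)) $ i $ j" for i j
    proof -
      have "N $ i $ j = (N *v axis j 1) $ i"
        by (simp add: matrix_vector_mult_basis column_def)
      also have "\<dots> = (M *v z j) $ i"
        by (simp add: z)
      also have "\<dots> = (M ** transpose (\<chi> i. z i)) $ i $ j"
        by (simp add: matrix_vector_mult_def matrix_matrix_mult_def transpose_def)
      finally show ?thesis .
    qed
    then show ?thesis
      by (simp add: vec_eq_iff)
  qed
  then show ?thesis
    by (rule that)
qed

text \<open>For a symmetric matrix the orthogonal complement of the range is the kernel.\<close>

lemma symmetric_matrix_decomp: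
  fixes M :: "real^'n^'n"
  assumes "transpose M = M"
  obtains z k where "y = M *v z + k" "M *v k = 0"
proof -
  obtain r k where r: "r \<in> span (range ((*v) M))"
    and k: "\<And>w. w \<in> span (range ((*v) M)) \<Longrightarrow> orthogonal k w" and y: "y = r + k"
    using orthogonal_subspace_decomp_exists[of "range ((*v) M)" y] by blast
  have "r \<in> range ((*v) M)"
    using r column_space_eq_range[of M] by (metis column_space_def span_span)
  moreover have "M *v k = 0"
  proof -
    \<comment> \<open>By symmetry, pairing \<open>k\<close> with this range vector gives the squared
      norm of \<open>M *v k\<close>.\<close>
    have "orthogonal k (M *v (M *v k))"
      by (rule k) (simp add: span_base)
    then have "(M *v k) \<bullet> (M *v k) = 0"
      using inner_matrix_symmetric[OF assms, of k "M *v k"] by (simp add: orthogonal_def)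
    then show ?thesis
      by simp
  qed
  ultimately show ?thesis
    using that y by blast
qed

text \<open>The first and third Penrose equations determine \<open>M ** G\<close>, the first and
  fourth determine \<open>G ** M\<close>, and \<open>G = G ** M ** G\<close> recovers
  \<open>G\<close> from these products.\<close>

lemma is_moore_penrose_unique:
  assumes "is_moore_penrose M G" "is_moore_penrose M K"
  shows "G = (K :: real^'m^'n)"
proof -
  have G: "M ** G ** M = M" "G ** M ** G = G" "transpose (M ** G) = M ** G"
      "transpose (G ** M) = G ** M"
    and K: "M ** K ** M = M" "K ** M ** K = K" "transpose (M ** K) = M ** K"
      "transpose (K ** M) = K ** M"
    using assms by (auto simp: is_moore_penrose_def)
  have "M ** G = transpose (M ** K ** M ** G)"
    using G K by simp
  also have "\<dots> = M ** G ** (M ** K)"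
    using G(3) K(3) matrix_transpose_mul[of "M ** K" "M ** G"] by (simp add: matrix_mul_assoc)
  also have "\<dots> = M ** K"
    using G by (simp add: matrix_mul_assoc)
  finally have MG: "M ** G = M ** K" .
  have "G ** M = transpose (G ** (M ** K ** M))"
    using G K by simp
  also have "\<dots> = K ** M ** (G ** M)"
    using G(4) K(4) matrix_transpose_mul[of "G ** M" "K ** M"] by (simp add: matrix_mul_assoc)
  also have "\<dots> = K ** (M ** G ** M)"
    by (simp add: matrix_mul_assoc)
  also have "\<dots> = K ** M"
    using G by simp
  finally have GM: "G ** M = K ** M" .
  have "G = G ** (M ** G)"
    using G(2) by (simp add: matrix_mul_assoc)
  also have "\<dots> = G ** M ** K"
    by (simp add: MG matrix_mul_assoc)
  also have "\<dots> = K"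
    using GM K(2) by simp
  finally show ?thesis .
qed

text \<open>For symmetric \<open>M\<close> the column spaces of \<open>M\<close> and \<open>M\<^sup>2\<close> agree, so \<open>M = M\<^sup>2 U\<close> for some \<open>U\<close>, and then
  \<open>U\<^sup>T M U\<close> is the Moore-Penrose inverse.\<close>
lemma is_moore_penrose_exists_symmetric:
  fixes M :: "real^'n^'n"
  assumes sym: "transpose M = M"
  shows "\<exists>G. is_moore_penrose M G"
proof -
  have "column_space M \<subseteq> column_space (M ** M)"
  proof (clarsimp simp: column_space_eq_range)
    fix x
    obtain z k where "x = M *v z + k" "M *v k = 0"
      by (rule symmetric_matrix_decomp[OF sym])
    then have "M *v x = (M ** M) *v z"
      by (simp add: matrix_vector_right_distrib matrix_vector_mul_assoc)
    then show "M *v x \<in> range ((*v) (M ** M))"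
      by blast
  qed
  then obtain U where U: "M = M ** M ** U"
    by (rule column_space_subset_factor)
  let ?T = "transpose U"
  have U': "M = ?T ** M ** M"
    using arg_cong[OF U, of transpose] by (simp add: matrix_transpose_mul sym matrix_mul_assoc)
  \<comment> \<open>Both sides equal \<open>?T ** M ** M ** U\<close>. Hence \<open>M ** U\<close>
    is symmetric; it is the orthogonal projection onto the column space, and the candidate inverse
    yields it as product with \<open>M\<close> on either side.\<close>
  have UM: "?T ** M = M ** U"
  proof -
    have "?T ** M = ?T ** M ** M ** U"
      using U by (metis matrix_mul_assoc)
    then show ?thesis
      using U' by metis
  qed
  have ME: "M ** (M ** U) = M" and EM: "M ** U ** M = M"
    using U U' UM by (simp_all add: matrix_mul_assoc)
  have MG: "M ** (?T ** M ** U) = M ** U"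
  proof -
    have "M ** (?T ** M ** U) = M ** (M ** U) ** U"
      unfolding UM by (simp add: matrix_mul_assoc)
    then show ?thesis
      unfolding ME .
  qed
  have GM: "?T ** M ** U ** M = M ** U"
  proof -
    have "?T ** M ** U ** M = ?T ** (M ** U ** M)"
      by (simp add: matrix_mul_assoc)
    then show ?thesis
      unfolding EM UM .
  qed
  have "is_moore_penrose M (?T ** M ** U)"
    unfolding is_moore_penrose_def MG GM
  proof (intro conjI)
    show "M ** U ** M = M"
      by (rule EM)
    have "M ** U ** (?T ** M ** U) = ?T ** (M ** (?T ** M ** U))"
      unfolding UM[symmetric] by (simp add: matrix_mul_assoc)
    then show "M ** U ** (?T ** M ** U) = ?T ** M ** U"
      unfolding MG by (simp add: matrix_mul_assoc)
    show "transpose (M ** U) = M ** U" "transpose (M ** U) = M ** U"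
      by (simp_all add: matrix_transpose_mul sym UM)
  qed
  then show ?thesis ..
qed

lemma moore_penrose_symmetric_ginverse:
  fixes M :: "real^'n^'n"
  assumes "transpose M = M"
  shows "M ** moore_penrose M ** M = M"
proof -
  have "is_moore_penrose M (moore_penrose M)"
    unfolding moore_penrose_def
    using is_moore_penrose_exists_symmetric[OF assms] is_moore_penrose_unique
    by (metis theI')
  then show ?thesis
    by (simp add: is_moore_penrose_def)
qed

subsection \<open>Nonnegative definite matrices and eigenvalues\<close>

text \<open>A zero of a nonnegative form is a minimum, so the gradient, twice \<open>Q *v x\<close>,
  vanishes there. The proof moves from \<open>x\<close> along \<open>Q *v x\<close>.\<close>

lemma nonneg_definite_null:
  fixes Q :: "real^'n^'n"
  assumes "nonneg_definite Q" "x \<bullet> (Q *v x) = 0"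
  shows "Q *v x = 0"
proof -
  define y where "y = Q *v x"
  define a c where "a = y \<bullet> y" and "c = y \<bullet> (Q *v y)"
  have sym: "transpose Q = Q" and nonneg: "\<And>x. 0 \<le> x \<bullet> (Q *v x)"
    using assms(1) by (auto simp: nonneg_definite_def)
  have "0 \<le> a" "0 \<le> c"
    by (simp_all add: a_def c_def nonneg)
  have "x \<bullet> (Q *v y) = a"
    by (simp add: inner_matrix_symmetric[OF sym] a_def y_def)
  then have "(x + t *\<^sub>R y) \<bullet> (Q *v (x + t *\<^sub>R y)) = 2 * t * a + t\<^sup>2 * c" for t
    using assms(2)
    by (simp add: matrix_vector_right_distrib matrix_vector_mult_scaleR inner_add_left
        inner_add_right c_def a_def power2_eq_square algebra_simps flip: y_def)
  \<comment> \<open>A small negative multiple of \<open>y\<close> lowers the form unless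
    \<open>a = 0\<close>. The choice \<open>t = - a / (c + 1)\<close> also covers
    \<open>c = 0\<close>.\<close>
  then have "0 \<le> 2 * (- a / (c + 1)) * a + (- a / (c + 1))\<^sup>2 * c"
    using nonneg by metis
  also have "\<dots> = - (a\<^sup>2 * (c + 2)) / (c + 1)\<^sup>2"
    using \<open>0 \<le> c\<close> by (simp add: divide_simps power2_eq_square) (simp add: algebra_simps)
  finally have "a\<^sup>2 * (c + 2) \<le> 0"
    using \<open>0 \<le> c\<close> by (simp add: divide_simps power2_eq_square zero_le_mult_iff split: if_splits)
  then have "a = 0"
    using \<open>0 \<le> c\<close> by (simp add: mult_le_0_iff)
  then show ?thesis
    by (simp add: a_def y_def)
qed

lemma nonneg_definite_congruence:
  fixes M :: "real^'n^'n" and B :: "real^'n^'m"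
  assumes "nonneg_definite M"
  shows "nonneg_definite (B ** M ** transpose B)"
  unfolding nonneg_definite_def
proof (intro conjI allI)
  show "transpose (B ** M ** transpose B) = B ** M ** transpose B"
    using assms by (simp add: matrix_transpose_mul nonneg_definite_def matrix_mul_assoc)
  fix x :: "real^'m"
  have "x \<bullet> ((B ** M ** transpose B) *v x) = (transpose B *v x) \<bullet> (M *v (transpose B *v x))"
    using inner_matrix_transpose[of x B] by (metis matrix_vector_mul_assoc)
  then show "0 \<le> x \<bullet> ((B ** M ** transpose B) *v x)"
    using assms by (simp add: nonneg_definite_def)
qed

lemma eigenvectors_linear_independent:
  fixes M :: "real^'n^'n"
  assumes "finite S" "\<And>l. l \<in> S \<Longrightarrow> v l \<noteq> 0 \<and> M *v v l = l *\<^sub>R v l"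
    and "(\<Sum>l\<in>S. c l *\<^sub>R v l) = 0" "l \<in> S"
  shows "c l = 0"
  using assms
proof (induction S arbitrary: c l rule: finite_induct)
  case (insert m S)
  have sum0: "c m *\<^sub>R v m + (\<Sum>l\<in>S. c l *\<^sub>R v l) = 0"
    using insert by simp
  have "M *v (\<Sum>l\<in>S. c l *\<^sub>R v l) = (\<Sum>l\<in>S. (c l * l) *\<^sub>R v l)"
    using insert.prems(1)
    by (simp add: linear_sum[OF matrix_vector_mul_linear] matrix_vector_mult_scaleR)
  then have eq1: "(c m * m) *\<^sub>R v m + (\<Sum>l\<in>S. (c l * l) *\<^sub>R v l) = 0"
    using arg_cong[OF sum0, of "(*v) M"] insert.prems(1)
    by (simp add: matrix_vector_right_distrib matrix_vector_mult_scaleR)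
  have eq2: "(c m * m) *\<^sub>R v m + (\<Sum>l\<in>S. (c l * m) *\<^sub>R v l) = 0"
    using arg_cong[OF sum0, of "scaleR m"]
    by (simp add: scaleR_right_distrib scaleR_sum_right mult.commute)
  have "(\<Sum>l\<in>S. (c l * l) *\<^sub>R v l) = (\<Sum>l\<in>S. (c l * m) *\<^sub>R v l)"
    by (rule add_left_imp_eq[OF trans[OF eq1 eq2[symmetric]]])
  \<comment> \<open>Applying \<open>M\<close> to the relation and subtracting \<open>m\<close> times
    it eliminates \<open>v m\<close>; the factors \<open>l - m\<close> are nonzero on
    \<open>S\<close>.\<close>
  then have "(\<Sum>l\<in>S. (c l * (l - m)) *\<^sub>R v l) = 0"
    by (simp add: sum_subtractf scaleR_left_diff_distrib right_diff_distrib)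
  then have "c l * (l - m) = 0" if "l \<in> S" for l
    using insert.IH[of "\<lambda>l. c l * (l - m)" l] insert.prems(1) that by simp
  then have S0: "c l = 0" if "l \<in> S" for l
    using that insert.hyps(2) by force
  then have "c m = 0"
    using sum0 insert.prems(1) by simp
  then show ?case
    using S0 insert.prems(3) by blast
qed simp

text \<open>Finiteness lets \<open>Max\<close> in \<open>lambda_max\<close> bound every eigenvalue.
  More than \<open>CARD('n)\<close> eigenvalues would give too many independent
  eigenvectors.\<close>

lemma finite_eigenvalues: "finite (eigenvalues (M :: real^'n^'n))"
proof (rule ccontr)
  assume "infinite (eigenvalues M)"
  then obtain S where S: "finite S" "card S = Suc CARD('n)" "S \<subseteq> eigenvalues M"
    using infinite_arbitrarily_large by blast
  then have "\<forall>l\<in>S. \<exists>v. v \<noteq> 0 \<and> M *v v = l *\<^sub>R v"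
    by (auto simp: eigenvalues_def)
  then obtain v where v: "\<And>l. l \<in> S \<Longrightarrow> v l \<noteq> 0 \<and> M *v v l = l *\<^sub>R v l"
    by metis
  have inj: "inj_on v S"
    by (rule inj_onI) (metis v scaleR_right_imp_eq)
  have "independent (v ` S)"
  proof (rule independent_if_scalars_zero)
    show "finite (v ` S)"
      using S by simp
    fix f x
    assume "(\<Sum>x\<in>v ` S. f x *\<^sub>R x) = 0" "x \<in> v ` S"
    then show "f x = 0"
      using eigenvectors_linear_independent[OF S(1) v, of "f \<circ> v"]
      by (auto simp: sum.reindex[OF inj])
  qed
  then have "card (v ` S) \<le> CARD('n)"
    using independent_bound by fastforce
  then show False
    using S by (simp add: card_image[OF inj])
qed

text \<open>The maximum \<open>\<mu>\<close> of \<open>x\<^sup>T N x / x\<^sup>T M x\<close> over the column space of \<open>M\<close> is attained at some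
  \<open>x\<close> with \<open>N x = \<mu> M x\<close>. As \<open>N G M = N\<close>, the vector \<open>M x\<close> is an eigenvector of \<open>N G\<close> for \<open>\<mu>\<close>.\<close>
lemma nonneg_definite_diff_if_lambda_max_le_one:
  fixes M N G :: "real^'n^'n"
  assumes M: "nonneg_definite M" and N: "nonneg_definite N"
    and cs: "column_space N \<subseteq> column_space M"
    and G: "ginverse M G" and lmax: "lambda_max (N ** G) \<le> 1"
  shows "nonneg_definite (M - N)"
proof (cases "M = 0")
  case True
  \<comment> \<open>This case is separate because the unit sphere of a zero column space is empty,
    so no maximizer exists.\<close>
  obtain Z where "N = M ** Z"
    using cs by (rule column_space_subset_factor)
  then have "M - N = 0"
    using True by simp
  moreover have "nonneg_definite (0 :: real^'n^'n)"
    by (simp add: nonneg_definite_def transpose_def vec_eq_iff)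
  ultimately show ?thesis
    by metis
next
  case False
  have symM: "transpose M = M" and symN: "transpose N = N"
    and M0: "\<And>x. 0 \<le> x \<bullet> (M *v x)" and N0: "\<And>x. 0 \<le> x \<bullet> (N *v x)"
    using M N unfolding nonneg_definite_def by blast+
  obtain Z where Z: "N = M ** Z"
    using cs by (rule column_space_subset_factor)
  have Z': "N = transpose Z ** M"
    using arg_cong[OF Z, of transpose] by (simp add: matrix_transpose_mul symM symN)
  \<comment> \<open>The range inclusion makes this hold for every generalized inverse
    \<open>G\<close> of \<open>M\<close>.\<close>
  have NGM: "N ** G ** M = N"
  proof -
    have "N ** G ** M = transpose Z ** (M ** G ** M)"
      by (simp add: Z' matrix_mul_assoc)
    then show ?thesis
      using G Z' by (simp add: ginverse_def)
  qed
  have kerN: "N *v k = 0" if "M *v k = 0" for k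
    using that by (metis Z' matrix_vector_mul_assoc matrix_vector_mult_0_right)
  define K where "K = column_space M \<inter> sphere 0 1"
  define f where "f x = (x \<bullet> (N *v x)) / (x \<bullet> (M *v x))" for x
  have subspace: "subspace (column_space M)"
    by (simp add: column_space_def)
  \<comment> \<open>On its column space the form of \<open>M\<close> is definite: a vector in both
    range and kernel is orthogonal to itself. The quotient \<open>f\<close> is therefore continuous
    on \<open>K\<close>.\<close>
  have pos: "0 < x \<bullet> (M *v x)" if x: "x \<in> column_space M" "x \<noteq> 0" for x
  proof (rule ccontr)
    assume "\<not> 0 < x \<bullet> (M *v x)"
    then have "M *v x = 0"
      using M0[of x] by (intro nonneg_definite_null[OF M]) linarith
    moreover obtain z where "x = M *v z"
      using x by (auto simp: column_space_eq_range)
    ultimately have "x \<bullet> x = 0"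
      using inner_matrix_symmetric[OF symM, of x z] by simp
    with x show False
      by simp
  qed
  obtain w where "M *v w \<noteq> 0"
    using False by (auto simp: matrix_eq)
  then have "(1 / norm (M *v w)) *\<^sub>R (M *v w) \<in> K"
    unfolding K_def using subspace_scale[OF subspace]
    by (simp add: column_space_eq_range)
  then have ne: "K \<noteq> {}"
    by blast
  have comp: "compact K"
    unfolding K_def by (intro closed_Int_compact closed_subspace subspace compact_sphere)
  have cont: "continuous_on K f"
  proof -
    have "continuous_on K ((*v) A)" for A :: "real^'n^'n"
      by (intro linear_continuous_on matrix_vector_mul_bounded_linear)
    moreover have "\<forall>x\<in>K. x \<bullet> (M *v x) \<noteq> 0"
      using pos by (force simp: K_def)
    ultimately show ?thesis
      unfolding f_def by (intro continuous_intros) auto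
  qed
  obtain x where x: "x \<in> K" "\<And>y. y \<in> K \<Longrightarrow> f y \<le> f x"
    using continuous_attains_sup[OF comp ne cont] by blast
  define \<mu> where "\<mu> = f x"
  have x': "x \<in> column_space M" "x \<noteq> 0"
    using x by (auto simp: K_def)
  \<comment> \<open>The quotient is invariant under scaling, so its bound on the unit sphere extends
    to the whole column space.\<close>
  have le_range: "r \<bullet> (N *v r) \<le> \<mu> * (r \<bullet> (M *v r))" if r: "r \<in> column_space M" for r
  proof (cases "r = 0")
    case False
    have "(1 / norm r) *\<^sub>R r \<in> K"
      using r False subspace_scale[OF subspace] by (simp add: K_def)
    then have "f ((1 / norm r) *\<^sub>R r) \<le> \<mu>"
      unfolding \<mu>_def by (rule x)
    also have "f ((1 / norm r) *\<^sub>R r) = f r"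
      using False by (simp add: f_def matrix_vector_mult_scaleR)
    finally show ?thesis
      using pos[OF r False] by (simp add: f_def divide_le_eq)
  qed simp
  \<comment> \<open>The kernel component of \<open>y\<close> contributes to neither form, as
    \<open>N\<close> vanishes on the kernel of \<open>M\<close>.\<close>
  have le: "y \<bullet> (N *v y) \<le> \<mu> * (y \<bullet> (M *v y))" for y
  proof -
    obtain z k where y: "y = M *v z + k" and k: "M *v k = 0"
      by (rule symmetric_matrix_decomp[OF symM])
    have "y \<bullet> (A *v y) = (M *v z) \<bullet> (A *v (M *v z))"
      if "transpose A = A" "A *v k = 0" for A
      using that inner_matrix_symmetric[OF that(1), of k "M *v z"]
      by (simp add: y matrix_vector_right_distrib inner_add_left)
    then show ?thesis
      using le_range[of "M *v z"] symM symN k kerN by (simp add: column_space_eq_range)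
  qed
  \<comment> \<open>The maximizer \<open>x\<close> is a zero of this nonnegative form, hence a null
    vector of the matrix.\<close>
  have "nonneg_definite (\<mu> *\<^sub>R M - N)"
    using le
    by (simp add: nonneg_definite_def transpose_diff transpose_scaleR symM symN
        matrix_vector_mult_diff_rdistrib inner_diff_right flip: scaleR_matrix_vector_assoc)
  moreover have "x \<bullet> ((\<mu> *\<^sub>R M - N) *v x) = 0"
    using pos[OF x']
    by (simp add: matrix_vector_mult_diff_rdistrib inner_diff_right \<mu>_def f_def
        flip: scaleR_matrix_vector_assoc)
  ultimately have "(\<mu> *\<^sub>R M - N) *v x = 0"
    by (rule nonneg_definite_null)
  then have Nx: "N *v x = \<mu> *\<^sub>R (M *v x)"
    by (simp add: matrix_vector_mult_diff_rdistrib flip: scaleR_matrix_vector_assoc)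
  have "(N ** G) *v (M *v x) = \<mu> *\<^sub>R (M *v x)"
    using NGM Nx by (simp add: matrix_vector_mul_assoc)
  moreover have "M *v x \<noteq> 0"
    using pos[OF x'] by auto
  ultimately have "\<mu> \<in> eigenvalues (N ** G)"
    by (auto simp: eigenvalues_def)
  then have "\<mu> \<le> 1"
    using lmax Max_ge[OF finite_eigenvalues] unfolding lambda_max_def by force
  have "y \<bullet> (N *v y) \<le> y \<bullet> (M *v y)" for y
    using le[of y] mult_right_mono[OF \<open>\<mu> \<le> 1\<close> M0[of y]] by simp
  then show ?thesis
    by (simp add: nonneg_definite_def transpose_diff symM symN
        matrix_vector_mult_diff_rdistrib inner_diff_right)
qed

subsection \<open>Rank-one matrices\<close>

lemma outer_mult_vector: "outer u v *v x = (v \<bullet> x) *\<^sub>R u"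
  by (simp add: outer_def vec_eq_iff matrix_vector_mult_def inner_vec_def sum_distrib_left
      mult.assoc mult.commute mult.left_commute)

lemma transpose_outer: "transpose (outer u v) = outer v u"
  by (simp add: outer_def transpose_def vec_eq_iff mult.commute)

text \<open>Boundedness gives integrability of outer products and lets linear maps built from
  \<open>outer\<close> pass through the integral.\<close>

lemma bounded_bilinear_outer: "bounded_bilinear (outer :: real^'m \<Rightarrow> real^'n \<Rightarrow> real^'n^'m)"
proof -
  have "bilinear (outer :: real^'m \<Rightarrow> real^'n \<Rightarrow> real^'n^'m)"
    unfolding bilinear_def
    by (auto intro!: linearI simp: outer_def vec_eq_iff algebra_simps)
  then show ?thesis
    by (simp add: bilinear_conv_bounded_bilinear)
qed

lemma outer_matrix_mult: "outer (B *v u) (B *v v) = B ** outer u v ** transpose B"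
  by (simp add: matrix_eq outer_mult_vector matrix_vector_mult_scaleR dot_lmul_matrix
      inner_commute flip: matrix_vector_mul_assoc) (metis dot_lmul_matrix inner_commute)

text \<open>With \<open>b = D z\<close>, membership of \<open>b\<close> in the column space of \<open>D\<close> turns the bound on
  \<open>b\<^sup>T D\<^sup>+ b\<close> into \<open>z\<^sup>T D z \<le> 1\<close>.\<close>
lemma nonneg_definite_minus_outer_iff:
  fixes D :: "real^'n^'n"
  assumes D: "nonneg_definite D"
  shows "nonneg_definite (D - outer b b) \<longleftrightarrow>
    b \<bullet> (moore_penrose D *v b) \<le> 1 \<and> b \<in> column_space D"
proof -
  have sym: "transpose D = D" and D0: "\<And>x. 0 \<le> x \<bullet> (D *v x)"
    using D by (auto simp: nonneg_definite_def)
  have mp: "b \<bullet> (moore_penrose D *v b) = z \<bullet> (D *v z)" if "b = D *v z" for z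
  proof -
    have "b \<bullet> (moore_penrose D *v b) = z \<bullet> ((D ** moore_penrose D ** D) *v z)"
      by (simp add: that inner_matrix_symmetric[OF sym] flip: matrix_vector_mul_assoc)
    then show ?thesis
      by (simp add: moore_penrose_symmetric_ginverse[OF sym])
  qed
  \<comment> \<open>The quadratic form of \<open>outer b b\<close> is the square of
    \<open>b \<bullet> x\<close>.\<close>
  have iff: "nonneg_definite (D - outer b b) \<longleftrightarrow> (\<forall>x. (b \<bullet> x)\<^sup>2 \<le> x \<bullet> (D *v x))"
    by (simp add: nonneg_definite_def transpose_diff sym transpose_outer outer_mult_vector
        matrix_vector_mult_diff_rdistrib inner_diff_right power2_eq_square inner_commute)
  show ?thesis
  proof
    assume "nonneg_definite (D - outer b b)"
    then have le: "(b \<bullet> x)\<^sup>2 \<le> x \<bullet> (D *v x)" for x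
      by (simp add: iff)
    obtain z k where b: "b = D *v z + k" and k: "D *v k = 0"
      by (rule symmetric_matrix_decomp[OF sym])
    \<comment> \<open>Testing the inequality on the kernel component of \<open>b\<close> removes
      that component.\<close>
    have "b \<bullet> k = 0"
      using le[of k] k by simp
    moreover have "(D *v z) \<bullet> k = 0"
      using inner_matrix_symmetric[OF sym, of z k] k by simp
    ultimately have "b = D *v z"
      by (simp add: b inner_add_left)
    \<comment> \<open>At \<open>x = z\<close> the inequality reads \<open>s\<^sup>2 \<le> s\<close>
      with \<open>s = z \<bullet> (D *v z)\<close>.\<close>
    moreover have "(z \<bullet> (D *v z))\<^sup>2 \<le> 1 * (z \<bullet> (D *v z))"
      using le[of z] by (simp add: \<open>b = D *v z\<close> inner_commute)
    then have "z \<bullet> (D *v z) \<le> 1"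
      using D0[of z] unfolding power2_eq_square
      by (cases "z \<bullet> (D *v z) = 0") (auto simp: mult_le_cancel_right)
    ultimately show "b \<bullet> (moore_penrose D *v b) \<le> 1 \<and> b \<in> column_space D"
      using mp by (auto simp: column_space_eq_range)
  next
    assume *: "b \<bullet> (moore_penrose D *v b) \<le> 1 \<and> b \<in> column_space D"
    then obtain z where z: "b = D *v z"
      by (auto simp: column_space_eq_range)
    have z1: "z \<bullet> (D *v z) \<le> 1"
      using * mp[OF z] by simp
    have "(b \<bullet> x)\<^sup>2 \<le> x \<bullet> (D *v x)" for x
    proof -
      define t where "t = b \<bullet> x"
      have t: "x \<bullet> (D *v z) = t" "z \<bullet> (D *v x) = t"
        by (simp_all add: t_def z inner_commute[of x] inner_matrix_symmetric[OF sym, of z x])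
      \<comment> \<open>This is the Cauchy-Schwarz argument for the form of \<open>D\<close>, with a
        multiple of \<open>z\<close> that needs no division by
        \<open>z \<bullet> (D *v z)\<close>.\<close>
      have "0 \<le> (x - t *\<^sub>R z) \<bullet> (D *v (x - t *\<^sub>R z))"
        by (rule D0)
      also have "\<dots> = x \<bullet> (D *v x) - 2 * t\<^sup>2 + t\<^sup>2 * (z \<bullet> (D *v z))"
        by (simp add: matrix_vector_mult_diff_distrib matrix_vector_mult_scaleR inner_diff_left
            inner_diff_right t power2_eq_square algebra_simps)
      also have "\<dots> \<le> x \<bullet> (D *v x) - 2 * t\<^sup>2 + t\<^sup>2 * 1"
        by (intro add_left_mono mult_left_mono z1) simp
      finally show ?thesis
        by (simp add: t_def)
    qed
    then show "nonneg_definite (D - outer b b)"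
      by (simp add: iff)
  qed
qed

subsection \<open>Moments of affine transformations\<close>

text \<open>The vector \<open>c\<close> is the bias. The cross terms are linear in the centred
  vector and integrate to zero; the second moment makes all terms integrable.\<close>

lemma MMSE_affine:
  fixes X :: "'w \<Rightarrow> real^'n" and B :: "real^'n^'m"
  assumes P: "prob_space P"
    and X: "X \<in> borel_measurable P" "integrable P (\<lambda>\<omega>. (norm (X \<omega>))\<^sup>2)"
    and Y: "\<And>\<omega>. Y \<omega> - \<theta> = B *v (X \<omega> - integral\<^sup>L P X) + c"
  shows "MMSE P Y \<theta> = B ** covariance_matrix P X ** transpose B + outer c c"
proof -
  interpret prob_space P
    by (rule P)
  have [measurable]: "X \<in> borel_measurable P"
    by (rule X)
  have intX: "integrable P X"
    using square_integrable_imp_integrable[of "\<lambda>\<omega>. norm (X \<omega>)"] X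
    by (simp add: integrable_norm_iff)
  define u where "u \<omega> = X \<omega> - integral\<^sup>L P X" for \<omega>
  have intu: "integrable P u"
    unfolding u_def using intX by simp
  have Eu: "integral\<^sup>L P u = 0"
    unfolding u_def using intX by (simp add: prob_space)
  have [measurable]: "u \<in> borel_measurable P"
    unfolding u_def by measurable
  have intu2: "integrable P (\<lambda>\<omega>. (norm (u \<omega>))\<^sup>2)"
  proof (rule Bochner_Integration.integrable_bound)
    show "integrable P (\<lambda>\<omega>. 2 * (norm (X \<omega>))\<^sup>2 + 2 * (norm (integral\<^sup>L P X))\<^sup>2)"
      using X by simp
    have "(norm (u \<omega>))\<^sup>2 \<le> 2 * (norm (X \<omega>))\<^sup>2 + 2 * (norm (integral\<^sup>L P X))\<^sup>2" for \<omega>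
    proof -
      have "(norm (u \<omega>))\<^sup>2 \<le> (norm (X \<omega>) + norm (integral\<^sup>L P X))\<^sup>2"
        unfolding u_def by (intro power_mono norm_triangle_ineq4) simp
      also have "\<dots> \<le> 2 * (norm (X \<omega>))\<^sup>2 + 2 * (norm (integral\<^sup>L P X))\<^sup>2"
        using sum_squares_bound[of "norm (X \<omega>)" "norm (integral\<^sup>L P X)"]
        by (simp add: power2_sum)
      finally show ?thesis .
    qed
    then show "AE \<omega> in P. norm ((norm (u \<omega>))\<^sup>2)
        \<le> norm (2 * (norm (X \<omega>))\<^sup>2 + 2 * (norm (integral\<^sup>L P X))\<^sup>2)"
      by (intro AE_I2) (auto intro: order_trans[OF _ abs_ge_self])
  qed measurable
  obtain k where k: "\<And>a b. norm (outer a b :: real^'n^'n) \<le> norm a * norm b * k"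
    using bounded_bilinear.bounded[OF bounded_bilinear_outer] by blast
  \<comment> \<open>The norm of the outer product is at most a constant times the squared norm of
    \<open>u\<close>.\<close>
  have intuu: "integrable P (\<lambda>\<omega>. outer (u \<omega>) (u \<omega>))"
  proof (rule Bochner_Integration.integrable_bound)
    show "integrable P (\<lambda>\<omega>. (norm (u \<omega>))\<^sup>2 * k)"
      using intu2 by simp
    show "AE \<omega> in P. norm (outer (u \<omega>) (u \<omega>)) \<le> norm ((norm (u \<omega>))\<^sup>2 * k)"
      using k by (intro AE_I2) (auto simp: power2_eq_square intro: order_trans[OF _ abs_ge_self])
    have "continuous_on UNIV (\<lambda>x. outer x x :: real^'n^'n)"
      by (intro bounded_bilinear.continuous_on[OF bounded_bilinear_outer] continuous_intros)
    then show "(\<lambda>\<omega>. outer (u \<omega>) (u \<omega>)) \<in> borel_measurable P"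
      by (rule borel_measurable_continuous_on) measurable
  qed
  let ?Q = "\<lambda>U. B ** U ** transpose B"
  let ?l = "\<lambda>v. outer (B *v v) c" and ?r = "\<lambda>v. outer c (B *v v)"
  have blB: "bounded_linear ((*v) B)"
    by (rule matrix_vector_mul_bounded_linear)
  have blQ: "bounded_linear ?Q"
    by (intro linear_conv_bounded_linear[THEN iffD1] linearI)
      (simp_all add: matrix_eq matrix_vector_mult_add_rdistrib matrix_vector_right_distrib
        matrix_vector_mult_scaleR
        flip: matrix_vector_mul_assoc scaleR_matrix_vector_assoc)
  have bll: "bounded_linear ?l"
    using bounded_bilinear.bounded_linear_left[OF bounded_bilinear_outer] blB
    by (rule bounded_linear_compose)
  have blr: "bounded_linear ?r"
    using bounded_bilinear.bounded_linear_right[OF bounded_bilinear_outer] blB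
    by (rule bounded_linear_compose)
  have "MMSE P Y \<theta> =
      (LINT \<omega>|P. ?Q (outer (u \<omega>) (u \<omega>)) + ?l (u \<omega>) + ?r (u \<omega>) + outer c c)"
    unfolding MMSE_def Y u_def[symmetric] outer_matrix_mult[symmetric]
    by (intro Bochner_Integration.integral_cong refl)
      (simp add: bounded_bilinear.add_left[OF bounded_bilinear_outer]
        bounded_bilinear.add_right[OF bounded_bilinear_outer])
  also have "\<dots> = ?Q (LINT \<omega>|P. outer (u \<omega>) (u \<omega>)) + ?l (integral\<^sup>L P u)
      + ?r (integral\<^sup>L P u) + outer c c"
    using integrable_bounded_linear[OF blQ intuu] integrable_bounded_linear[OF bll intu]
      integrable_bounded_linear[OF blr intu]
      integral_bounded_linear[OF blQ intuu] integral_bounded_linear[OF bll intu]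
      integral_bounded_linear[OF blr intu]
    by (simp add: prob_space)
  also have "\<dots> = B ** covariance_matrix P X ** transpose B + outer c c"
    by (simp add: Eu covariance_matrix_def u_def Let_def
        bounded_bilinear.zero_left[OF bounded_bilinear_outer]
        bounded_bilinear.zero_right[OF bounded_bilinear_outer])
  finally show ?thesis .
qed

subsection \<open>The restriction and Liu matrices\<close>

lemma pos_definite_invertible:
  assumes "pos_definite M"
  shows "invertible M"
  unfolding invertible_left_inverse matrix_left_invertible_ker
  using assms by (force simp: pos_definite_def)

text \<open>Substituting \<open>x = M *v y\<close> turns the form of the inverse at \<open>x\<close>
  into that of \<open>M\<close> at \<open>y\<close>.\<close>

lemma pos_definite_matrix_inv:
  assumes "pos_definite M"
  shows "pos_definite (matrix_inv M)"
proof -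
  note inv = matrix_inv_invertible[OF pos_definite_invertible[OF assms]]
  have sym: "transpose M = M"
    using assms by (simp add: pos_definite_def)
  have "0 < x \<bullet> (matrix_inv M *v x)" if "x \<noteq> 0" for x
  proof -
    define y where "y = matrix_inv M *v x"
    have x: "x = M *v y"
      by (simp add: y_def matrix_vector_mul_assoc inv)
    then have "y \<noteq> 0"
      using that by auto
    then have "0 < y \<bullet> (M *v y)"
      using assms by (simp add: pos_definite_def)
    then show ?thesis
      by (metis x y_def inner_commute)
  qed
  then show ?thesis
    using transpose_matrix_inv_symmetric[OF pos_definite_invertible[OF assms] sym]
    by (simp add: pos_definite_def)
qed

text \<open>Full row rank makes \<open>transpose H\<close> injective, so definiteness survives the
  congruence.\<close>

lemma pos_definite_full_row_rank:
  fixes M :: "real^'n^'n" and H :: "real^'n^'q"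
  assumes M: "pos_definite M" and "rank H = CARD('q)"
  shows "pos_definite (H ** M ** transpose H)"
proof -
  have inj: "inj ((*v) (transpose H))"
    using assms(2) by (simp add: full_rank_injective[symmetric] rank_transpose)
  have "0 < x \<bullet> ((H ** M ** transpose H) *v x)" if "x \<noteq> 0" for x
  proof -
    have "transpose H *v x \<noteq> 0"
      using that injD[OF inj, of x 0] by auto
    then have "0 < (transpose H *v x) \<bullet> (M *v (transpose H *v x))"
      using M unfolding pos_definite_def by blast
    also have "\<dots> = x \<bullet> ((H ** M ** transpose H) *v x)"
      by (simp only: inner_matrix_transpose[of x H, symmetric] matrix_vector_mul_assoc
          matrix_mul_assoc)
    finally show ?thesis .
  qed
  then show ?thesis
    using M by (simp add: pos_definite_def matrix_transpose_mul matrix_mul_assoc)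
qed

text \<open>The matrix \<open>B\<close> maps the error of the unrestricted estimator to that of the
  restricted one. It is idempotent, and \<open>A\<close> equals both \<open>B ** T\<close> and
  \<open>T ** transpose B\<close>, where \<open>T\<close> is the inverse of \<open>C\<close>; all
  three claims follow.\<close>

lemma
  fixes C :: "real^'n^'n" and H :: "real^'n^'q"
  assumes C: "pos_definite C" and H: "rank H = CARD('q)"
  defines "A \<equiv> restr_matrix C H"
  defines "B \<equiv> mat 1 - matrix_inv C ** transpose H **
      matrix_inv (H ** matrix_inv C ** transpose H) ** H"
  shows restr_matrix_covariance: "B ** matrix_inv C ** transpose B = A"
    and restr_matrix_sandwich: "A ** C ** A = A"
    and nonneg_definite_restr_matrix: "nonneg_definite A"
proof -
  define T where "T = matrix_inv C"
  define S where "S = matrix_inv (H ** T ** transpose H)"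
  have invC: "invertible C"
    by (rule pos_definite_invertible[OF C])
  have TC: "T ** C = mat 1"
    unfolding T_def by (rule matrix_inv_invertible[OF invC])
  have T: "pos_definite T"
    unfolding T_def by (rule pos_definite_matrix_inv[OF C])
  then have symT: "transpose T = T"
    by (simp add: pos_definite_def)
  have HTH: "pos_definite (H ** T ** transpose H)"
    by (rule pos_definite_full_row_rank[OF T H])
  have symS: "transpose S = S"
    using pos_definite_matrix_inv[OF HTH] by (simp add: S_def pos_definite_def)
  have inv: "H ** T ** transpose H ** S = mat 1"
    unfolding S_def by (rule matrix_inv_invertible[OF pos_definite_invertible[OF HTH]])
  have A: "A = T - T ** transpose H ** S ** H ** T"
    by (simp add: A_def restr_matrix_def T_def S_def)
  have B: "B = mat 1 - T ** transpose H ** S ** H"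
    by (simp add: B_def T_def S_def)
  have BT: "B ** T = A"
    by (simp add: A B matrix_diff_rdistrib matrix_mul_assoc)
  have symA: "transpose A = A"
    by (simp add: A transpose_diff matrix_transpose_mul symT symS matrix_mul_assoc)
  have "A = transpose (B ** T)"
    using BT symA by simp
  then have TB: "T ** transpose B = A"
    by (simp add: matrix_transpose_mul symT)
  \<comment> \<open>The subtracted term in \<open>B\<close> is idempotent because its square
    contains \<open>H ** T ** transpose H ** S\<close>, the identity.\<close>
  have BB: "B ** B = B"
  proof -
    have "T ** transpose H ** S ** H ** (T ** transpose H ** S ** H)
        = T ** transpose H ** S ** (H ** T ** transpose H ** S) ** H"
      by (simp only: matrix_mul_assoc)
    then show ?thesis
      by (simp add: inv B matrix_diff_rdistrib matrix_diff_ldistrib)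
  qed
  show cov: "B ** matrix_inv C ** transpose B = A"
  proof -
    have "B ** T ** transpose B = B ** (T ** transpose B)"
      by (simp add: matrix_mul_assoc)
    also have "\<dots> = B ** (B ** T)"
      by (simp only: TB BT)
    also have "\<dots> = B ** B ** T"
      by (rule matrix_mul_assoc)
    also have "\<dots> = A"
      by (simp only: BB BT)
    finally show ?thesis
      by (simp add: T_def)
  qed
  show "A ** C ** A = A"
  proof -
    have "A ** C ** A = B ** (T ** C) ** (T ** transpose B)"
      unfolding TB by (simp add: BT matrix_mul_assoc)
    then show ?thesis
      using cov unfolding TC by (simp add: T_def matrix_mul_assoc)
  qed
  have "nonneg_definite T"
    using T unfolding nonneg_definite_def pos_definite_def
    by (metis inner_zero_left order_le_less)
  then show "nonneg_definite A"
    using nonneg_definite_congruence[of T B] cov by (simp add: T_def)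
qed

text \<open>Positive definiteness of \<open>C + mat 1\<close> ensures that \<open>matrix_inv\<close>
  is a true inverse and inherits symmetry.\<close>

lemma transpose_liu_matrix:
  assumes "pos_definite C"
  shows "transpose (liu_matrix C d) = liu_matrix C d"
proof -
  have "pos_definite (C + mat 1)"
    unfolding pos_definite_def
  proof (intro conjI allI impI)
    show "transpose (C + mat 1) = C + mat 1"
      using assms by (simp add: transpose_add pos_definite_def)
    fix x :: "real^'a"
    assume "x \<noteq> 0"
    then have "0 < x \<bullet> (C *v x) + x \<bullet> x"
      using assms by (intro add_pos_pos) (auto simp: pos_definite_def)
    then show "0 < x \<bullet> ((C + mat 1) *v x)"
      by (simp add: matrix_vector_mult_add_rdistrib inner_add_right)
  qed
  then have "transpose (matrix_inv (C + mat 1)) = matrix_inv (C + mat 1)"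
    using pos_definite_matrix_inv by (auto simp: pos_definite_def)
  then show ?thesis
    by (simp add: liu_matrix_def transpose_diff transpose_scaleR matrix_transpose_mul)
qed

theorem theorem3p3:
  fixes P :: "'w measure"
    and mle :: "'w \<Rightarrow> real^'n"
    and \<beta> b1 :: "real^'n"
    and C A L G :: "real^'n^'n"
    and H :: "real^'n^'q"
    and h :: "real^'q"
    and d :: real
  assumes "prob_space P"
    and "mle \<in> borel_measurable P"
    and "integrable P (\<lambda>\<omega>. (norm (mle \<omega>))\<^sup>2)"
    and "pos_definite C"
    and "integral\<^sup>L P mle = \<beta>"
    and "covariance_matrix P mle = matrix_inv C"
    and "rank H = CARD('q)"
    and "H *v \<beta> = h"
    and "0 < d" and "d < 1"
    and L: "L = liu_matrix C d"
    and A: "A = restr_matrix C H"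
    and b1: "b1 = (L - mat 1) *v \<beta>"
    and "ginverse (A ** C ** A) G"
    and "lambda_max (L ** A ** L ** G) \<le> 1"
    and "column_space (L ** A ** L) \<subseteq> column_space (A ** C ** A)"
  shows "MMSE_superior P \<beta> (\<lambda>\<omega>. RAULE C H h d (mle \<omega>)) (\<lambda>\<omega>. RMLE C H h (mle \<omega>)) \<longleftrightarrow>
      b1 \<bullet> (moore_penrose (A ** C ** A - L ** A ** L) *v b1) \<le> 1 \<and>
      b1 \<in> column_space (A ** C ** A - L ** A ** L)"
proof -
  note C = \<open>pos_definite C\<close> and rank = \<open>rank H = CARD('q)\<close>
  define B where "B = mat 1 - matrix_inv C ** transpose H **
      matrix_inv (H ** matrix_inv C ** transpose H) ** H"
  have symL: "transpose L = L"
    unfolding L by (rule transpose_liu_matrix[OF C])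
  have ACA: "A ** C ** A = A" and A0: "nonneg_definite A"
    and cov: "B ** matrix_inv C ** transpose B = A"
    unfolding A B_def
    by (rule restr_matrix_sandwich[OF C rank] nonneg_definite_restr_matrix[OF C rank]
        restr_matrix_covariance[OF C rank])+
  have LAL0: "nonneg_definite (L ** A ** L)"
    using nonneg_definite_congruence[OF A0, of L] symL by simp
  \<comment> \<open>Once \<open>A ** C ** A\<close> is replaced by \<open>A\<close>, the hypotheses
    on \<open>G\<close> compare \<open>L ** A ** L\<close> with \<open>A\<close>.\<close>
  have D: "nonneg_definite (A - L ** A ** L)"
    using assms(14-16) unfolding ACA
    by (intro nonneg_definite_diff_if_lambda_max_le_one[OF A0 LAL0])
  \<comment> \<open>The true restrictions turn \<open>H *v b - h\<close> into
    \<open>H *v (b - \<beta>)\<close>, so the restricted estimator is unbiased.\<close>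
  have R: "RMLE C H h b - \<beta> = B *v (b - \<beta>)" for b
    by (simp add: RMLE_def B_def matrix_vector_mult_diff_rdistrib matrix_vector_mult_diff_distrib
        \<open>H *v \<beta> = h\<close> flip: matrix_vector_mul_assoc)
  \<comment> \<open>Adding and subtracting \<open>L *v \<beta>\<close> isolates the bias
    \<open>b1\<close>.\<close>
  have "RAULE C H h d b - \<beta> = L *v (RMLE C H h b - \<beta>) + b1" for b
    by (simp add: RAULE_def L b1 matrix_vector_mult_diff_rdistrib matrix_vector_mult_diff_distrib)
  then have RA: "RAULE C H h d b - \<beta> = (L ** B) *v (b - \<beta>) + b1" for b
    by (simp add: R matrix_vector_mul_assoc)
  note affine = MMSE_affine[OF assms(1-3), unfolded assms(5,6)]
  have "MMSE P (\<lambda>\<omega>. RMLE C H h (mle \<omega>)) \<beta> = A"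
    using affine[of _ \<beta> B 0] R cov
    by (simp add: bounded_bilinear.zero_left[OF bounded_bilinear_outer])
  moreover have "MMSE P (\<lambda>\<omega>. RAULE C H h d (mle \<omega>)) \<beta> = L ** A ** L + outer b1 b1"
  proof -
    have "L ** B ** matrix_inv C ** transpose (L ** B) = L ** A ** L"
      by (simp add: matrix_transpose_mul symL matrix_mul_assoc flip: cov)
    then show ?thesis
      using affine[of "\<lambda>\<omega>. RAULE C H h d (mle \<omega>)" \<beta> "L ** B" b1] RA by simp
  qed
  \<comment> \<open>The difference of the two error matrices is
    \<open>A - L ** A ** L - outer b1 b1\<close>, to which the rank-one criterion applies.\<close>
  ultimately show ?thesis
    using nonneg_definite_minus_outer_iff[OF D, of b1]
    by (simp add: MMSE_superior_def ACA diff_diff_eq)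
qed

end
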